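(* For every integer $n\geq 1$, the algorithm $\mathrm{EnumBPeq0}$ (described in the context) on input $n$ enumerates $\mathsf{BP}_n^0$: identifying each output with the partitioned order it represents, all outputs belong to $\mathsf{BP}_n$, and for every equivalence class of $\equiv_0$ on $\mathsf{BP}_n$ exactly one output (counted with multiplicity) belongs to that class.
   Context: Notation: $\llbracket n\rrbracket=\{0,\dots,n-1\}$. A partitioned order of $\llbracket n\rrbracket$ is an (unordered) set $\{S_k\}_{k\in\llbracket s\rrbracket}$ of $s$ sequences $S_k=(i^k_0,\dots,i^k_{n_k-1})$ with $n_k>0$, each consisting of pairwise distinct elements of $\llbracket n\rrbracket$, the sequences being pairwise disjoint (as sets of entries) with union $\llbracket n\rrbracket$. The sequences are called o-blocks. $\mathsf{BP}_n$ is the set of all partitioned orders of $\llbracket n\rrbracket$ (block-parallel update modes of size $n$). For $\mu=\{S_k\}_{k\in\llbracket s\rrbracket}\in\mathsf{BP}_n$, let $p=\mathrm{lcm}(n_0,\dots,n_{s-1})$ and define the sequence of blocks $\varphi(\mu)=(W_\ell)_{\ell\in\llbracket p\rrbracket}$ by $W_\ell=\{i^k_{\ell \bmod n_k}\mid k\in\llbracket s\rrbracket\}$. For $\mu,\mu'\in\mathsf{BP}_n$, $\mu\equiv_0\mu'$ means $\varphi(\mu)=\varphi(\mu')$; $\mathsf{BP}_n^0=\mathsf{BP}_n/\equiv_0$. Integer partitions: $p(n)$ is the number of integer partitions of $n$, listed in some fixed order as partitions number $1,\dots,p(n)$; $d(i)$ is the maximal part size of the $i$-th partition, and $m(i,j)$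 is the multiplicity of the part of size $j$ in it (possibly $0$). Matrix representation: a list $M=(M_1,\dots,M_{d(i)})$, where $M_j$ is a matrix with $m(i,j)$ rows and $j$ columns (empty if $m(i,j)=0$) such that each element of $\llbracket n\rrbracket$ is an entry exactly once overall, represents the partitioned order whose o-blocks are all the rows of all the matrices (each row read from left to right). Algorithm $\mathrm{EnumBPeq0}(n)$: for each partition $i$ of $n$, call $\mathrm{Aux}(n,i,1)$. $\mathrm{Aux}(n,i,j,M_1,\dots,M_{j-1})$: (1) If $d(i)<j$, output $M=(M_1,\dots,M_{j-1})$ and return. (2) Otherwise, if $m(i,j)>0$: for each subset $A$ of size $j\cdot m(i,j)$ of the elements of $\llbracket n\rrbracket$ not occurring in $M_1,\dots,M_{j-1}$, and for each matrix $M_j$ enumerated by $\mathrm{Block}(A,j,m(i,j))$, call $\mathrm{Aux}(n,i,j+1,M_1,\dots,M_{j-1},M_j)$. (3) Otherwise ($m(i,j)=0$), call $\mathrm{Aux}(n,i,j+1,M_1,\dots,M_{j-1},\emptyset)$. $\mathrm{Block}(A,j,m)$: for each list of columns $C=(C_1,\dots,C_j)$ enumerated by $\mathrm{BlockAux}(A,m)$, enumerate the matrix $M_j$ with $M_j[k][\ell]=C_\ell[k]$ for $1\le k\le m$, $1\le\ell\le j$, where the elements of each set $C_\ell$ are listed in some fixed order (e.g. increasing) as $C_\ell[1],\dots,C_\ell[m]$. $\mathrm{BlockAux}(A,m,C_1,\dots,C_\ell)$: if $A=\emptyset$, enumerate $(C_1,\dots,C_\ell)$ and return; otherwise, for each subset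 $B\subseteq A$ of size $m$, call $\mathrm{BlockAux}(A\setminus B,m,C_1,\dots,C_\ell,B)$. *)

theory Defs
  imports Main "HOL-Library.Multiset" "HOL-Library.Disjoint_Sets"
begin

text \<open>The set \<open>\<lbrakk>n\<rbrakk>\<close> is \<open>{..<n}\<close>; an o-block is a list, and a
  block-parallel update mode is a set of o-blocks.\<close>

definition BP :: "nat \<Rightarrow> nat list set set" where
  "BP n = {\<mu>. (\<forall>S\<in>\<mu>. S \<noteq> [] \<and> distinct S) \<and> disjoint_family_on set \<mu> \<and> (\<Union>S\<in>\<mu>. set S) = {..<n}}"

definition phi :: "nat list set \<Rightarrow> nat set list" where
  "phi \<mu> = map (\<lambda>l. (\<lambda>S. S ! (l mod length S)) ` \<mu>) [0..<Lcm (length ` \<mu>)]"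

definition equiv0 :: "nat \<Rightarrow> (nat list set \<times> nat list set) set" where
  "equiv0 n = {(\<mu>, \<mu>'). \<mu> \<in> BP n \<and> \<mu>' \<in> BP n \<and> phi \<mu> = phi \<mu>'}"

definition BP0 :: "nat \<Rightarrow> nat list set set set" where
  "BP0 n = BP n // equiv0 n"

text \<open>An integer partition is the multiset of its parts, so that the multiplicity of
  the part \<open>j\<close> in \<open>P\<close> is \<open>count P j\<close>.\<close>

definition int_partitions :: "nat \<Rightarrow> nat multiset set" where
  "int_partitions n = {P. 0 \<notin># P \<and> \<Sum>\<^sub># P = n}"

definition max_part :: "nat multiset \<Rightarrow> nat" where
  "max_part P = Max (set_mset P)"

lemma finite_int_partitions: "finite (int_partitions n)"
proof -
  have "int_partitions n \<subseteq> mset ` {xs. set xs \<subseteq> {..n} \<and> length xs \<le> n}"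
  proof
    fix P assume "P \<in> int_partitions n"
    then have pos: "0 \<notin># P" and sum: "\<Sum>\<^sub># P = n" by (auto simp: int_partitions_def)
    obtain xs where xs: "P = mset xs" by (metis ex_mset)
    have le: "x \<le> n" if "x \<in> set xs" for x
      using member_le_sum_list[OF that] sum xs by (simp add: sum_mset_sum_list)
    have "length xs \<le> sum_list xs" if "0 \<notin> set xs"
      using that by (induction xs) auto
    then have "length xs \<le> n"
      using pos sum xs by (simp add: sum_mset_sum_list)
    with le xs show "P \<in> mset ` {xs. set xs \<subseteq> {..n} \<and> length xs \<le> n}" by auto
  qed
  then show ?thesis
    by (rule finite_subset) (simp add: finite_lists_length_le)
qed

text \<open>A matrix is the list of its rows, and \<open>(M\<^sub>1, M\<^sub>2, \<dots>)\<close> is the list of these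
  matrices, so \<open>M\<^sub>j\<close> is \<open>M ! (j - 1)\<close>.\<close>

type_synonym matrix = "nat list list"

definition matrix_representation :: "nat \<Rightarrow> nat multiset \<Rightarrow> matrix list \<Rightarrow> bool" where
  "matrix_representation n P M \<longleftrightarrow>
     length M = max_part P \<and>
     (\<forall>j\<in>{1..max_part P}. length (M ! (j - 1)) = count P j \<and>
        (\<forall>r\<in>set (M ! (j - 1)). length r = j)) \<and>
     mset (concat (concat M)) = mset_set {..<n}"

definition represented_order :: "matrix list \<Rightarrow> nat list set" where
  "represented_order M = set (concat M)"

text \<open>An enumeration is the multiset of everything that is output, each \<open>for each\<close> loop
  over a finite set being a sum over that set; the order of the outputs is irrelevant.
  The parameter \<open>lst\<close> gives the fixed order in which the elements of a set are listed.\<close>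

definition listing :: "nat \<Rightarrow> (nat set \<Rightarrow> nat list) \<Rightarrow> bool" where
  "listing n lst \<longleftrightarrow> (\<forall>C\<subseteq>{..<n}. distinct (lst C) \<and> set (lst C) = C)"

lemma listing_sorted_list_of_set: "listing n sorted_list_of_set"
  by (auto simp: listing_def dest: finite_subset)

text \<open>The algorithm only calls \<open>block_aux\<close> with \<open>A\<close> finite and \<open>m > 0\<close>; the last branch
  merely makes the function total.\<close>

function block_aux :: "nat set \<Rightarrow> nat \<Rightarrow> nat set list \<Rightarrow> nat set list multiset" where
  "block_aux A m Cs =
     (if A = {} then {#Cs#}
      else if finite A \<and> m > 0 then \<Sum>B\<in>{B. B \<subseteq> A \<and> card B = m}. block_aux (A - B) m (Cs @ [B])
      else {#})"
  by pat_completeness auto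
termination
proof (relation "measure (\<lambda>(A, m, Cs). card A)", goal_cases)
  case (2 A m Cs B)
  then have "B \<subseteq> A" "B \<noteq> {}" "finite A" by auto
  then have "A - B \<subset> A" by auto
  with \<open>finite A\<close> show ?case by (simp add: psubset_card_mono)
qed simp

declare block_aux.simps [simp del]

definition block :: "(nat set \<Rightarrow> nat list) \<Rightarrow> nat set \<Rightarrow> nat \<Rightarrow> nat \<Rightarrow> matrix multiset" where
  "block lst A j m =
     {# map (\<lambda>k. map (\<lambda>l. lst (C ! l) ! k) [0..<j]) [0..<m]. C \<in># block_aux A m [] #}"

function aux :: "(nat set \<Rightarrow> nat list) \<Rightarrow> nat \<Rightarrow> nat multiset \<Rightarrow> nat \<Rightarrow> matrix list
    \<Rightarrow> matrix list multiset" where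
  "aux lst n P j M =
     (if max_part P < j then {#M#}
      else if count P j > 0 then
        \<Sum>A\<in>{A. A \<subseteq> {..<n} - set (concat (concat M)) \<and> card A = j * count P j}.
          \<Sum>Mj\<in>#block lst A j (count P j). aux lst n P (j + 1) (M @ [Mj])
      else aux lst n P (j + 1) (M @ [[]]))"
  by pat_completeness auto
termination
  by (relation "measure (\<lambda>(lst, n, P, j, M). max_part P + 1 - j)") auto

declare aux.simps [simp del]

definition EnumBPeq0 :: "(nat set \<Rightarrow> nat list) \<Rightarrow> nat \<Rightarrow> matrix list multiset" where
  "EnumBPeq0 lst n = (\<Sum>P\<in>int_partitions n. aux lst n P 1 [])"

end

theory Submission
  imports Defs
begin

text \<open>For an o-block \<open>S\<close> of length \<open>j\<close>, the entry \<open>S ! l\<close> occurs in \<open>phi \<mu>\<close> exactly at the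
  times congruent to \<open>l\<close> modulo \<open>j\<close>. As \<open>j\<close> divides the length of \<open>phi \<mu>\<close>, both \<open>j\<close> and \<open>l\<close>
  can be read off these times, so a class of \<open>\<equiv>\<^sub>0\<close> amounts to the family of the sets
  \<open>cols \<mu> j l\<close> of \<open>l\<close>-th entries of the o-blocks of length \<open>j\<close>. The algorithm chooses each such
  family exactly once, namely as the columns of the matrices \<open>M\<^sub>j\<close>.\<close>

section \<open>Equivalence classes and their columns\<close>

definition cols :: "nat list set \<Rightarrow> nat \<Rightarrow> nat \<Rightarrow> nat set" where
  "cols \<mu> j l = (\<lambda>S. S ! l) ` {S \<in> \<mu>. length S = j}"

lemma BP_unique_block:
  assumes "\<mu> \<in> BP n" "S \<in> \<mu>" "S' \<in> \<mu>" "x \<in> set S" "x \<in> set S'"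
  shows "S = S'"
  using assms unfolding BP_def disjoint_family_on_def by blast

lemma BP_unique_index:
  assumes "\<mu> \<in> BP n" "S \<in> \<mu>" "S' \<in> \<mu>" "i < length S" "i' < length S'" "S ! i = S' ! i'"
  shows "S = S' \<and> i = i'"
proof -
  have eq: "S = S'"
    using BP_unique_block[OF assms(1-3), of "S ! i"] assms(4-6) nth_mem by metis
  moreover have "distinct S" using assms(1,2) by (auto simp: BP_def)
  ultimately show ?thesis using assms(4-6) by (simp add: nth_eq_iff_index_eq)
qed

text \<open>An o-block is nonempty and determined by any one of its entries, so \<open>set\<close>
  embeds \<open>\<mu>\<close> into the subsets of \<open>{..<n}\<close>.\<close>

lemma BP_finite:
  assumes "\<mu> \<in> BP n"
  shows "finite \<mu>"
proof (rule finite_imageD)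
  have "set ` \<mu> \<subseteq> Pow {..<n}" using assms by (auto simp: BP_def)
  then show "finite (set ` \<mu>)" by (rule finite_subset) simp
  show "inj_on set \<mu>"
  proof (rule inj_onI)
    fix S S' assume S: "S \<in> \<mu>" "S' \<in> \<mu>" "set S = set S'"
    then have "hd S \<in> set S" "hd S \<in> set S'" using assms by (auto simp: BP_def)
    then show "S = S'" using BP_unique_block[OF assms S(1,2)] by blast
  qed
qed

lemma BP_length_pos: "\<mu> \<in> BP n \<Longrightarrow> S \<in> \<mu> \<Longrightarrow> 0 < length S"
  by (auto simp: BP_def)

lemma length_phi_pos:
  assumes "\<mu> \<in> BP n"
  shows "0 < length (phi \<mu>)"
proof -
  have "Lcm (length ` \<mu>) \<noteq> 0"
    using BP_finite[OF assms] BP_length_pos[OF assms] by (auto simp: Lcm_0_iff)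
  then show ?thesis by (simp add: phi_def)
qed

lemma length_dvd_length_phi: "S \<in> \<mu> \<Longrightarrow> length S dvd length (phi \<mu>)"
  by (simp add: phi_def)

lemma nth_phi: "t < length (phi \<mu>) \<Longrightarrow> phi \<mu> ! t = (\<lambda>S. S ! (t mod length S)) ` \<mu>"
  by (simp add: phi_def)

text \<open>Every element has a unique place in \<open>\<mu>\<close>, so \<open>S ! l\<close> can
  enter a block of \<open>phi \<mu>\<close> only through \<open>S\<close> itself, at index
  \<open>l\<close>.\<close>

lemma mem_nth_phi_iff:
  assumes "\<mu> \<in> BP n" "S \<in> \<mu>" "l < length S" "t < length (phi \<mu>)"
  shows "S ! l \<in> phi \<mu> ! t \<longleftrightarrow> t mod length S = l"
proof
  assume "S ! l \<in> phi \<mu> ! t"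
  then obtain S' where S': "S' \<in> \<mu>" "S ! l = S' ! (t mod length S')"
    by (auto simp: nth_phi[OF assms(4)])
  moreover have "t mod length S' < length S'"
    using BP_length_pos[OF assms(1) S'(1)] by simp
  ultimately show "t mod length S = l"
    using BP_unique_index[OF assms(1,2) S'(1) assms(3)] by blast
qed (use assms nth_phi[OF assms(4)] in auto)

text \<open>The time \<open>l\<close> lies in both classes, whence \<open>l mod j' = l'\<close>. If
  \<open>l + j < p\<close>, this is a second common time, and the difference \<open>j\<close> must
  be a multiple of \<open>j'\<close>. The conclusion is one-sided; exchanging the roles of the
  classes gives equality.\<close>

lemma residue_class_determined:
  fixes j j' l l' p :: nat
  assumes "0 < p" "j dvd p" "j' dvd p" "l < j" "l' < j'"
    and eq: "\<And>t. t < p \<Longrightarrow> t mod j = l \<longleftrightarrow> t mod j' = l'"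
  shows "l' \<le> l \<and> j' \<le> j"
proof -
  have le: "j \<le> p" "j' \<le> p" using assms by (auto dest: dvd_imp_le)
  have l: "l mod j' = l'" using eq[of l] assms(4) le by simp
  have "j' \<le> j"
  \<comment> \<open>If \<open>j = p\<close>, the first class has only one time below
    \<open>p\<close>, but then \<open>j' \<le> p\<close> is already the claim. Otherwise
    \<open>p\<close> is at least \<open>2 * j\<close>, which leaves room for
    \<open>l + j\<close>.\<close>
  proof (cases "j = p")
    case False
    from \<open>j dvd p\<close> obtain k where k: "p = j * k" by blast
    have "k \<noteq> 0" "k \<noteq> 1" using k False \<open>0 < p\<close> by auto
    then have "2 \<le> k" by simp
    then have "j * 2 \<le> p" unfolding k by (rule mult_le_mono2)
    then have "l + j < p" using \<open>l < j\<close> by simp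
    then have "(l + j) mod j' = l mod j'" using eq[of "l + j"] l \<open>l < j\<close> by simp
    then have "j' dvd j" using mod_eq_dvd_iff_nat[of l "l + j" j'] by simp
    then show ?thesis using \<open>l < j\<close> by (simp add: dvd_imp_le)
  qed (use le in simp)
  moreover have "l' \<le> l" using l by (metis mod_less_eq_dividend)
  ultimately show ?thesis by simp
qed

text \<open>An element \<open>x\<close> at index \<open>l\<close> of \<open>S\<close> in
  \<open>\<mu>\<close> sits at some index \<open>l'\<close> of some \<open>S'\<close> in
  \<open>\<mu>'\<close>. The times of \<open>x\<close> in the common value of \<open>phi\<close>
  form both residue classes, so length and index agree.\<close>

lemma cols_subset_if_phi_eq:
  assumes \<mu>: "\<mu> \<in> BP n" and \<mu>': "\<mu>' \<in> BP n" and eq: "phi \<mu> = phi \<mu>'" and "l < j"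
  shows "cols \<mu> j l \<subseteq> cols \<mu>' j l"
proof
  fix x assume "x \<in> cols \<mu> j l"
  then obtain S where S: "S \<in> \<mu>" "length S = j" "x = S ! l" by (auto simp: cols_def)
  have "x \<in> set S" using S \<open>l < j\<close> by simp
  then have "x \<in> {..<n}" using \<mu> S(1) unfolding BP_def by blast
  then obtain S' where S': "S' \<in> \<mu>'" "x \<in> set S'" using \<mu>' unfolding BP_def by blast
  then obtain l' where l': "l' < length S'" "x = S' ! l'" by (auto simp: in_set_conv_nth)
  let ?p = "length (phi \<mu>)"
  have iff: "t mod j = l \<longleftrightarrow> t mod length S' = l'" if "t < ?p" for t
    using mem_nth_phi_iff[OF \<mu> S(1), of l t] mem_nth_phi_iff[OF \<mu>' S'(1) l'(1), of t]
      that S \<open>l < j\<close> l' eq by auto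
  have "0 < ?p" "j dvd ?p" "length S' dvd ?p"
    using length_phi_pos[OF \<mu>] length_dvd_length_phi[OF S(1)] length_dvd_length_phi[OF S'(1)]
      eq S(2) by auto
  then have "l = l'" "j = length S'"
    using residue_class_determined[of ?p j "length S'" l l'] iff \<open>l < j\<close> l'(1)
      residue_class_determined[of ?p "length S'" j l' l] by (auto intro!: antisym)
  then show "x \<in> cols \<mu>' j l" using S' l' by (auto simp: cols_def)
qed

lemma phi_eq_if_cols_eq:
  assumes \<mu>: "\<mu> \<in> BP n" and \<mu>': "\<mu>' \<in> BP n"
    and eq: "\<And>j l. l < j \<Longrightarrow> cols \<mu> j l = cols \<mu>' j l"
  shows "phi \<mu> = phi \<mu>'"
proof -
  \<comment> \<open>Columns of index \<open>0\<close> already show which lengths occur, and hence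
    the period of \<open>phi\<close>.\<close>
  have len: "length ` \<nu> = {j. 0 < j \<and> cols \<nu> j 0 \<noteq> {}}" if "\<nu> \<in> BP n" for \<nu>
    using BP_length_pos[OF that] by (auto simp: cols_def)
  \<comment> \<open>Grouping the o-blocks by length turns each block of \<open>phi\<close> into a
    union of columns with index \<open>t mod j < j\<close>.\<close>
  have W: "(\<lambda>S. S ! (t mod length S)) ` \<nu> = (\<Union>j\<in>{0<..}. cols \<nu> j (t mod j))"
    if "\<nu> \<in> BP n" for \<nu> t
    using BP_length_pos[OF that] unfolding cols_def by fastforce
  have "length ` \<mu> = length ` \<mu>'"
    unfolding len[OF \<mu>] len[OF \<mu>'] using eq by (metis (no_types))
  moreover have "(\<lambda>S. S ! (t mod length S)) ` \<mu> = (\<lambda>S. S ! (t mod length S)) ` \<mu>'" for t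
    unfolding W[OF \<mu>] W[OF \<mu>'] using eq by (intro SUP_cong) auto
  ultimately show ?thesis by (simp add: phi_def)
qed

lemma phi_eq_iff:
  assumes "\<mu> \<in> BP n" "\<mu>' \<in> BP n"
  shows "phi \<mu> = phi \<mu>' \<longleftrightarrow> (\<forall>j. \<forall>l<j. cols \<mu> j l = cols \<mu>' j l)"
  using cols_subset_if_phi_eq[OF assms] cols_subset_if_phi_eq[OF assms(2,1)]
    phi_eq_if_cols_eq[OF assms] by (metis subset_antisym)

text \<open>Different o-blocks have different \<open>l\<close>-th entries, so any single column
  reveals the number of o-blocks of length \<open>j\<close>.\<close>

lemma card_cols:
  assumes "\<mu> \<in> BP n" "l < j"
  shows "card (cols \<mu> j l) = card {S \<in> \<mu>. length S = j}"
  unfolding cols_def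
  by (rule card_image) (use BP_unique_index[OF assms(1)] assms(2) in \<open>auto intro!: inj_onI\<close>)

lemma Union_cols: "(\<Union>l<j. cols \<mu> j l) = (\<Union>S\<in>{S \<in> \<mu>. length S = j}. set S)"
  unfolding cols_def by (fastforce simp: in_set_conv_nth)

section \<open>The integer partition of an update mode\<close>

text \<open>This is the only partition for which the algorithm outputs a member of the class of
  \<open>\<mu>\<close>.\<close>

definition lengths :: "nat list set \<Rightarrow> nat multiset" where
  "lengths \<mu> = image_mset length (mset_set \<mu>)"

lemma count_lengths:
  assumes "\<mu> \<in> BP n"
  shows "count (lengths \<mu>) j = card {S \<in> \<mu>. length S = j}"
proof -
  have "count (lengths \<mu>) j = size {#S \<in># mset_set \<mu>. length S = j#}"
    unfolding lengths_def count_conv_size_mset by (simp add: filter_mset_image_mset eq_commute)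
  then show ?thesis by (simp add: BP_finite[OF assms])
qed

lemma lengths_in_int_partitions:
  assumes "\<mu> \<in> BP n"
  shows "lengths \<mu> \<in> int_partitions n"
proof -
  have "(\<Sum>S\<in>\<mu>. length S) = (\<Sum>S\<in>\<mu>. card (set S))"
    using assms by (intro sum.cong) (auto simp: BP_def distinct_card)
  also have "\<dots> = card (\<Union>S\<in>\<mu>. set S)"
    using assms BP_finite[OF assms]
    by (subst card_UN_disjoint) (auto simp: BP_def disjoint_family_on_def)
  finally have "(\<Sum>S\<in>\<mu>. length S) = n" using assms by (simp add: BP_def)
  then show ?thesis
    using BP_finite[OF assms] BP_length_pos[OF assms]
    by (force simp: int_partitions_def lengths_def sum_unfold_sum_mset)
qed

section \<open>Column lists enumerated by \<open>block_aux\<close>\<close>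

text \<open>Disjointness is required between positions, which excludes repetitions of a nonempty
  set. In this form, splitting off the head of the list mirrors one recursive call of
  \<open>block_aux\<close>.\<close>

definition ordered_partition :: "nat set \<Rightarrow> nat \<Rightarrow> nat set list \<Rightarrow> bool" where
  "ordered_partition A m Cs \<longleftrightarrow>
     \<Union> (set Cs) = A \<and> sorted_wrt disjnt Cs \<and> (\<forall>C\<in>set Cs. card C = m)"

lemma ordered_partition_Nil: "ordered_partition A m [] \<longleftrightarrow> A = {}"
  by (auto simp: ordered_partition_def)

lemma ordered_partition_Cons:
  "ordered_partition A m (C # Cs) \<longleftrightarrow> C \<subseteq> A \<and> card C = m \<and> ordered_partition (A - C) m Cs"
  by (auto simp: ordered_partition_def disjnt_def)

lemma length_ordered_partition:
  assumes "finite A" "ordered_partition A m Cs"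
  shows "card A = length Cs * m"
  using assms
proof (induction Cs arbitrary: A)
  case (Cons C Cs)
  then have C: "C \<subseteq> A" "card C = m" and "card (A - C) = length Cs * m"
    by (auto simp: ordered_partition_Cons)
  with Cons.prems(1) show ?case
    using card_mono[OF Cons.prems(1) C(1)] by (simp add: card_Diff_subset finite_subset)
qed (simp add: ordered_partition_Nil)

text \<open>The accumulator \<open>Cs\<close> is a prefix of every output. For nonempty
  \<open>A\<close> the next set in \<open>X\<close> dictates the only choice of \<open>B\<close>
  whose branch can output \<open>X\<close>, so no list is produced twice.\<close>

lemma count_block_aux:
  assumes "finite A" "0 < m"
  shows "count (block_aux A m Cs) X = of_bool (\<exists>Ds. X = Cs @ Ds \<and> ordered_partition A m Ds)"
  using assms
proof (induction A m Cs rule: block_aux.induct)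
  case (1 A m Cs)
  show ?case
  proof (cases "A = {}")
    case True
    \<comment> \<open>Positivity of \<open>m\<close> matters: lists of empty sets would otherwise be
      further ordered partitions of the empty set.\<close>
    have "ordered_partition {} m Ds \<longleftrightarrow> Ds = []" for Ds
      using \<open>0 < m\<close> by (cases Ds) (auto simp: ordered_partition_Cons ordered_partition_Nil)
    then show ?thesis using True by (simp add: block_aux.simps[of "{}"])
  next
    case False
    let ?B = "{B. B \<subseteq> A \<and> card B = m}"
    have "count (block_aux A m Cs) X = (\<Sum>B\<in>?B. count (block_aux (A - B) m (Cs @ [B])) X)"
      using False 1(2,3) by (subst block_aux.simps) (simp add: count_sum)
    also have "\<dots> = (\<Sum>B\<in>?B. of_bool (\<exists>Ds. X = Cs @ B # Ds \<and> ordered_partition (A - B) m Ds))"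
      using 1 False by (intro sum.cong) simp_all
    also have "\<dots> = of_bool (\<exists>Ds. X = Cs @ Ds \<and> ordered_partition A m Ds)"
    proof (cases "\<exists>Ds. X = Cs @ Ds \<and> ordered_partition A m Ds")
      case True
      then obtain Ds where Ds: "X = Cs @ Ds" "ordered_partition A m Ds" by blast
      then obtain B0 Ds0 where B0: "Ds = B0 # Ds0"
        using False by (cases Ds) (auto simp: ordered_partition_Nil)
      have "(\<Sum>B\<in>?B. of_bool (\<exists>Ds. X = Cs @ B # Ds \<and> ordered_partition (A - B) m Ds))
          = (\<Sum>B\<in>?B. if B = B0 then 1 else 0 :: nat)"
        using Ds B0 by (intro sum.cong) (auto simp: ordered_partition_Cons)
      also have "\<dots> = 1"
        using Ds B0 1(2) by (simp add: ordered_partition_Cons)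
      finally show ?thesis using True by simp
    next
      case False
      then show ?thesis by (auto simp: ordered_partition_Cons intro!: sum.neutral)
    qed
    finally show ?thesis .
  qed
qed

lemma block_aux_ordered_partition:
  assumes "finite A" "0 < m" "Cs \<in># block_aux A m []"
  shows "ordered_partition A m Cs"
proof (rule ccontr)
  assume "\<not> ?thesis"
  then have "count (block_aux A m []) Cs = 0"
    by (simp add: count_block_aux[OF assms(1,2)])
  with assms(3) show False by (metis not_in_iff)
qed

section \<open>From column lists to matrices\<close>

text \<open>Isolates the map applied in \<open>block\<close>, so that counting matrices reduces to
  counting column lists.\<close>

definition matrix_of :: "(nat set \<Rightarrow> nat list) \<Rightarrow> nat \<Rightarrow> nat \<Rightarrow> nat set list \<Rightarrow> matrix" where
  "matrix_of lst j m Cs = map (\<lambda>k. map (\<lambda>l. lst (Cs ! l) ! k) [0..<j]) [0..<m]"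

lemma block_conv_matrix_of: "block lst A j m = image_mset (matrix_of lst j m) (block_aux A m [])"
  by (simp add: block_def matrix_of_def[abs_def])

text \<open>A set rather than a list: how the entries of different columns are joined into rows is
  invisible to \<open>phi\<close> and fixed arbitrarily by \<open>lst\<close>.\<close>

definition column :: "matrix \<Rightarrow> nat \<Rightarrow> nat set" where
  "column R l = (\<lambda>r. r ! l) ` set R"

lemma column_matrix_of:
  assumes "listing n lst" "Cs ! l \<subseteq> {..<n}" "card (Cs ! l) = m" "l < j"
  shows "column (matrix_of lst j m Cs) l = Cs ! l"
proof -
  have d: "distinct (lst (Cs ! l))" "set (lst (Cs ! l)) = Cs ! l"
    using assms(1,2) by (auto simp: listing_def)
  then have "length (lst (Cs ! l)) = m" using assms(3) distinct_card by fastforce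
  moreover have "column (matrix_of lst j m Cs) l = (\<lambda>k. lst (Cs ! l) ! k) ` {..<m}"
    using assms(4) by (auto simp: column_def matrix_of_def image_image lessThan_atLeast0)
  ultimately have "column (matrix_of lst j m Cs) l = set (lst (Cs ! l))"
    by (auto simp: in_set_conv_nth)
  with d show ?thesis by simp
qed

lemma set_concat_conv_column:
  assumes "\<forall>r\<in>set R. length r = j"
  shows "set (concat R) = (\<Union>l<j. column R l)"
  using assms by (fastforce simp: column_def in_set_conv_nth[where xs = "_ :: nat list"])

lemma length_concat_const:
  assumes "\<forall>r\<in>set R. length r = j"
  shows "length (concat R) = length R * j"
  using assms by (induction R) auto

text \<open>Splitting \<open>j * m\<close> elements into sets of size \<open>m\<close> forces
  exactly \<open>j\<close> sets, so \<open>matrix_of\<close> uses all of \<open>Cs\<close> and the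
  matrix determines its column list.\<close>

lemma block_column:
  assumes lst: "listing n lst" and A: "A \<subseteq> {..<n}" "card A = j * m" and "0 < m"
    and Cs: "Cs \<in># block_aux A m []"
  shows "length Cs = j" "l < j \<Longrightarrow> column (matrix_of lst j m Cs) l = Cs ! l"
proof -
  have fin: "finite A" using A(1) finite_subset by blast
  have part: "ordered_partition A m Cs"
    using block_aux_ordered_partition[OF fin \<open>0 < m\<close> Cs] .
  then show len: "length Cs = j"
    using length_ordered_partition[OF fin part] A(2) \<open>0 < m\<close> by simp
  assume "l < j"
  then have "Cs ! l \<in> set Cs" using len by simp
  then have "Cs ! l \<subseteq> {..<n}" "card (Cs ! l) = m"
    using part A(1) unfolding ordered_partition_def by blast+
  then show "column (matrix_of lst j m Cs) l = Cs ! l"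
    using column_matrix_of[OF lst] \<open>l < j\<close> by blast
qed

lemma block_matrix:
  assumes lst: "listing n lst" and A: "A \<subseteq> {..<n}" "card A = j * m" and "0 < m"
    and R: "R \<in># block lst A j m"
  shows "length R = m" "\<forall>r\<in>set R. length r = j" "set (concat R) = A" "distinct (concat R)"
proof -
  have fin: "finite A" using A(1) finite_subset by blast
  obtain Cs where Cs: "Cs \<in># block_aux A m []" "R = matrix_of lst j m Cs"
    using R by (auto simp: block_conv_matrix_of)
  show len: "length R = m" and row: "\<forall>r\<in>set R. length r = j"
    by (auto simp: Cs(2) matrix_of_def)
  note col = block_column[OF lst A \<open>0 < m\<close> Cs(1)]
  have "set (concat R) = (\<Union>l<j. Cs ! l)"
    unfolding set_concat_conv_column[OF row] using col(2) Cs(2) by auto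
  also have "\<dots> = \<Union> (set Cs)"
    using col(1) by (fastforce simp: in_set_conv_nth)
  finally show set: "set (concat R) = A"
    using block_aux_ordered_partition[OF fin \<open>0 < m\<close> Cs(1)] by (simp add: ordered_partition_def)
  \<comment> \<open>The number of entries equals the cardinality \<open>j * m\<close> of their set
    \<open>A\<close>, which rules out repetitions.\<close>
  show "distinct (concat R)"
    using length_concat_const[OF row] set A(2) len by (intro card_distinct) simp
qed

section \<open>Partial outputs and the validity of complete ones\<close>

text \<open>The invariant of \<open>aux\<close>: a prefix of a matrix representation need not yet
  use every element. Positions count from \<open>0\<close>, so \<open>M ! i\<close> holds the rows
  of length \<open>Suc i\<close>.\<close>

definition partial_representation :: "nat \<Rightarrow> nat multiset \<Rightarrow> matrix list \<Rightarrow> bool" where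
  "partial_representation n P M \<longleftrightarrow>
     (\<forall>i<length M. length (M ! i) = count P (Suc i) \<and> (\<forall>r\<in>set (M ! i). length r = Suc i)) \<and>
     distinct (concat (concat M)) \<and> set (concat (concat M)) \<subseteq> {..<n}"

lemma partial_representation_Nil: "partial_representation n P []"
  by (simp add: partial_representation_def)

lemma partial_representation_snoc:
  assumes "partial_representation n P M" "length R = count P (Suc (length M))"
    "\<forall>r\<in>set R. length r = Suc (length M)" "distinct (concat R)"
    "set (concat R) \<subseteq> {..<n} - set (concat (concat M))"
  shows "partial_representation n P (M @ [R])"
  using assms unfolding partial_representation_def
  by (auto simp: nth_append less_Suc_eq)

lemma partial_representation_block:
  assumes "listing n lst" "partial_representation n P M" "j = Suc (length M)" "0 < count P j"
    "A \<subseteq> {..<n} - set (concat (concat M))" "card A = j * count P j"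
    "R \<in># block lst A j (count P j)"
  shows "partial_representation n P (M @ [R])"
proof -
  have "A \<subseteq> {..<n}" using assms(5) by blast
  note R = block_matrix[OF assms(1) this assms(6,4,7)]
  show ?thesis
    by (rule partial_representation_snoc) (use R assms in auto)
qed

lemma partial_representation_empty:
  assumes "partial_representation n P M" "count P (Suc (length M)) = 0"
  shows "partial_representation n P (M @ [[]])"
  by (rule partial_representation_snoc) (use assms in auto)

lemma aux_partial_representation:
  assumes "listing n lst" "partial_representation n P M" "j = Suc (length M)" "j \<le> Suc (max_part P)"
    "M' \<in># aux lst n P j M"
  shows "partial_representation n P M' \<and> length M' = max_part P"
  using assms
proof (induction lst n P j M rule: aux.induct)
  case (1 lst n P j M)
  consider "max_part P < j" | "j \<le> max_part P" "count P j > 0" | "j \<le> max_part P" "count P j = 0"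
    by linarith
  then show ?case
  proof cases
    case 1
    then have "aux lst n P j M = {#M#}" by (subst aux.simps) simp
    \<comment> \<open>Together with \<open>j \<le> Suc (max_part P)\<close>, the stopping test gives
      \<open>j = Suc (max_part P)\<close>, so exactly \<open>max_part P\<close> matrices have been
      built.\<close>
    then show ?thesis using 1 "1.prems" by simp
  next
    case 2
    let ?As = "{A. A \<subseteq> {..<n} - set (concat (concat M)) \<and> card A = j * count P j}"
    have fin: "finite ?As" by (rule finite_subset[of _ "Pow {..<n}"]) auto
    have "M' \<in># (\<Sum>A\<in>?As. \<Sum>R\<in>#block lst A j (count P j). aux lst n P (j + 1) (M @ [R]))"
      using "1.prems"(5) 2 by (subst (asm) aux.simps) simp
    then obtain A R where AR: "A \<in> ?As" "R \<in># block lst A j (count P j)"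
      "M' \<in># aux lst n P (j + 1) (M @ [R])"
      using fin by (auto simp: set_mset_sum)
    have "partial_representation n P (M @ [R])"
      using AR 2 "1.prems" by (intro partial_representation_block[of n lst P M j A R]) auto
    then show ?thesis
      using "1.IH"(1)[of A R] AR 2 "1.prems" by simp
  next
    case 3
    then have "M' \<in># aux lst n P (j + 1) (M @ [[]])"
      using "1.prems"(5) by (subst (asm) aux.simps) simp
    moreover have "partial_representation n P (M @ [[]])"
      using partial_representation_empty "1.prems"(2,3) 3(2) by simp
    moreover have "\<not> max_part P < j" "\<not> 0 < count P j" using 3 by auto
    ultimately show ?thesis
      using "1.IH"(2) "1.prems" by simp
  qed
qed

lemma length_concat_concat:
  assumes "partial_representation n P M"
  shows "length (concat (concat M)) = (\<Sum>i<length M. count P (Suc i) * Suc i)"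
proof -
  have "length (concat (concat M)) = (\<Sum>R\<leftarrow>M. length (concat R))"
    by (induction M) auto
  also have "\<dots> = (\<Sum>i<length M. length (concat (M ! i)))"
    by (simp add: sum_list_sum_nth lessThan_atLeast0)
  also have "\<dots> = (\<Sum>i<length M. count P (Suc i) * Suc i)"
  proof (rule sum.cong)
    fix i assume "i \<in> {..<length M}"
    then have "length (M ! i) = count P (Suc i)" "\<forall>r\<in>set (M ! i). length r = Suc i"
      using assms by (auto simp: partial_representation_def)
    then show "length (concat (M ! i)) = count P (Suc i) * Suc i"
      using length_concat_const by metis
  qed simp
  finally show ?thesis .
qed

lemma sum_mset_conv_count:
  fixes P :: "nat multiset"
  assumes "finite A" "set_mset P \<subseteq> A"
  shows "\<Sum>\<^sub># P = (\<Sum>i\<in>A. count P i * i)"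
  using assms(2)
proof (induction P)
  case (add x P)
  have "(\<Sum>i\<in>A. count (add_mset x P) i * i)
      = (\<Sum>i\<in>A. count P i * i + (if i = x then x else 0))"
    by (rule sum.cong) auto
  then show ?case
    using add assms(1) by (simp add: sum.distrib)
qed simp

lemma int_partition_parts:
  assumes "P \<in> int_partitions n"
  shows "set_mset P \<subseteq> {1..max_part P}" "(\<Sum>i<max_part P. count P (Suc i) * Suc i) = n"
proof -
  show sub: "set_mset P \<subseteq> {1..max_part P}"
    using assms by (auto simp: int_partitions_def max_part_def Suc_le_eq intro!: Nat.gr0I)
  have "n = (\<Sum>i\<in>{1..max_part P}. count P i * i)"
    using assms sum_mset_conv_count[OF _ sub] by (simp add: int_partitions_def)
  also have "\<dots> = (\<Sum>i<max_part P. count P (Suc i) * Suc i)"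
    by (rule sum.reindex_bij_witness[of _ Suc "\<lambda>i. i - 1"]) auto
  finally show "(\<Sum>i<max_part P. count P (Suc i) * Suc i) = n" by simp
qed

text \<open>The prescribed matrix sizes account for \<open>n\<close> entries, and \<open>n\<close>
  distinct elements of \<open>{..<n}\<close> exhaust it.\<close>

lemma matrix_representation_if_complete:
  assumes "partial_representation n P M" "length M = max_part P" "P \<in> int_partitions n"
  shows "matrix_representation n P M"
proof -
  let ?xs = "concat (concat M)"
  have d: "distinct ?xs" "set ?xs \<subseteq> {..<n}"
    and rows: "\<forall>i<length M. length (M ! i) = count P (Suc i) \<and>
      (\<forall>r\<in>set (M ! i). length r = Suc i)"
    using assms(1) unfolding partial_representation_def by blast+
  have "card (set ?xs) = n"
    unfolding distinct_card[OF d(1)] length_concat_concat[OF assms(1)] assms(2)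
    by (rule int_partition_parts[OF assms(3)])
  then have "set ?xs = {..<n}" using d(2) by (simp add: card_subset_eq)
  then have "mset ?xs = mset_set {..<n}" using mset_set_set[OF d(1)] by simp
  moreover have "length (M ! (j - 1)) = count P j \<and> (\<forall>r\<in>set (M ! (j - 1)). length r = j)"
    if "j \<in> {1..max_part P}" for j
  proof -
    have "j - 1 < length M" "Suc (j - 1) = j" using that assms(2) by auto
    then show ?thesis using rows by metis
  qed
  ultimately show ?thesis using assms(2) by (simp add: matrix_representation_def)
qed

lemma represented_order_in_BP:
  assumes "matrix_representation n P M"
  shows "represented_order M \<in> BP n"
proof -
  have mset: "mset (concat (concat M)) = mset_set {..<n}"
    using assms by (simp add: matrix_representation_def)
  then have "distinct (concat (concat M))"
    by (simp add: distinct_count_atmost_1 flip: set_mset_mset count_mset)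
  moreover have "set (concat (concat M)) = {..<n}"
    using mset by (metis finite_lessThan finite_set_mset_mset_set set_mset_mset)
  moreover have "S \<noteq> []" if "S \<in> set (concat M)" for S
  proof -
    from that obtain i where i: "i < length M" "S \<in> set (M ! i)"
      by (auto simp: in_set_conv_nth[of _ M])
    then have "Suc i \<in> {1..max_part P}" "S \<in> set (M ! (Suc i - 1))"
      using assms by (auto simp: matrix_representation_def)
    then have "length S = Suc i"
      using assms unfolding matrix_representation_def by blast
    then show ?thesis by auto
  qed
  ultimately show ?thesis
    unfolding BP_def represented_order_def disjoint_family_on_def distinct_concat_iff by auto
qed

lemma aux_output:
  assumes "listing n lst" "P \<in> int_partitions n" "M \<in># aux lst n P 1 []"
  shows "partial_representation n P M" "length M = max_part P"
    "matrix_representation n P M" "represented_order M \<in> BP n"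
proof -
  show *: "partial_representation n P M" "length M = max_part P"
    using aux_partial_representation[OF assms(1) partial_representation_Nil _ _ assms(3)] by auto
  show "matrix_representation n P M"
    using matrix_representation_if_complete[OF * assms(2)] .
  then show "represented_order M \<in> BP n" by (rule represented_order_in_BP)
qed

section \<open>O-blocks and columns of an output\<close>

text \<open>The length of a row identifies the matrix that it comes from, so the set of all rows
  still separates the matrices.\<close>

lemma represented_order_length:
  assumes "partial_representation n P M" "0 < j"
  shows "{S \<in> represented_order M. length S = j} = (if j \<le> length M then set (M ! (j - 1)) else {})"
proof -
  have rows: "length r = Suc i" if "i < length M" "r \<in> set (M ! i)" for i r
    using that assms(1) by (simp add: partial_representation_def)
  have "represented_order M = (\<Union>i<length M. set (M ! i))"
    by (fastforce simp: represented_order_def in_set_conv_nth[of _ M])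
  moreover obtain i where "j = Suc i" using assms(2) by (cases j) auto
  ultimately show ?thesis using rows by (auto simp: Suc_le_eq)
qed

lemma cols_represented_order:
  assumes "partial_representation n P M" "0 < j"
  shows "cols (represented_order M) j l = (if j \<le> length M then column (M ! (j - 1)) l else {})"
  using represented_order_length[OF assms] by (simp add: cols_def column_def)

text \<open>Passing to a set of rows could merge equal rows. Distinct entries and nonempty rows
  prevent this, so multiplicities survive.\<close>

lemma count_lengths_represented_order:
  assumes "partial_representation n P M" "represented_order M \<in> BP n" "0 < j"
  shows "count (lengths (represented_order M)) j = (if j \<le> length M then count P j else 0)"
proof (cases "j \<le> length M")
  case True
  let ?R = "M ! (j - 1)"
  have "j - 1 < length M" "Suc (j - 1) = j" using True assms(3) by auto
  then have R: "length ?R = count P j" "\<forall>r\<in>set ?R. length r = j"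
    using assms(1) unfolding partial_representation_def by metis+
  have "concat ?R \<in> set (map concat M)" using True assms(3) by simp
  moreover have "concat (concat M) = concat (map concat M)" by (induction M) auto
  then have "distinct (concat (map concat M))"
    using assms(1) unfolding partial_representation_def by metis
  ultimately have "distinct (concat ?R)" unfolding distinct_concat_iff[of "map _ _"] by blast
  moreover have "[] \<notin> set ?R" using R(2) assms(3) by force
  ultimately have "distinct ?R" by (simp add: distinct_concat_iff)
  then show ?thesis
    using True R(1) represented_order_length[OF assms(1,3)] count_lengths[OF assms(2)]
    by (simp add: distinct_card)
next
  case False
  then show ?thesis
    using represented_order_length[OF assms(1,3)] count_lengths[OF assms(2), of j]
    by (simp only: if_False card.empty)
qed

section \<open>Counting outputs with prescribed columns\<close>

text \<open>Only the matrices present in \<open>M\<close> are constrained, so the condition can be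
  tested on partial outputs. The range \<open>l \<le> i\<close> covers the \<open>Suc i\<close>
  columns of \<open>M ! i\<close>.\<close>

definition matches :: "nat list set \<Rightarrow> matrix list \<Rightarrow> bool" where
  "matches \<mu> M \<longleftrightarrow> (\<forall>i<length M. \<forall>l\<le>i. column (M ! i) l = cols \<mu> (Suc i) l)"

lemma matches_snoc:
  "matches \<mu> (M @ [R]) \<longleftrightarrow>
     matches \<mu> M \<and> (\<forall>l\<le>length M. column R l = cols \<mu> (Suc (length M)) l)"
  by (auto simp: matches_def nth_append less_Suc_eq)

text \<open>A matrix from \<open>block\<close> has the right columns exactly when it stems from the
  list \<open>?T\<close> of the columns of \<open>\<mu>\<close>. That list is enumerated once if it
  is an ordered partition of \<open>A\<close>, and never otherwise.\<close>

lemma size_block_matching: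
  assumes \<mu>: "\<mu> \<in> BP n" and lst: "listing n lst"
    and A: "A \<subseteq> {..<n}" "card A = j * m" and m: "m = count (lengths \<mu>) j" "0 < m"
  shows "size {#R \<in># block lst A j m. \<forall>l<j. column R l = cols \<mu> j l#}
    = of_bool (A = (\<Union>l<j. cols \<mu> j l))"
proof -
  let ?T = "map (cols \<mu> j) [0..<j]"
  have fin: "finite A" using A(1) finite_subset by blast
  have "size {#R \<in># block lst A j m. \<forall>l<j. column R l = cols \<mu> j l#}
      = size {#Cs \<in># block_aux A m []. \<forall>l<j. column (matrix_of lst j m Cs) l = cols \<mu> j l#}"
    by (simp add: block_conv_matrix_of filter_mset_image_mset)
  also have "{#Cs \<in># block_aux A m []. \<forall>l<j. column (matrix_of lst j m Cs) l = cols \<mu> j l#}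
      = {#Cs \<in># block_aux A m []. Cs = ?T#}"
  proof (rule filter_mset_cong)
    fix Cs assume "Cs \<in># block_aux A m []"
    note col = block_column[OF lst A m(2) this]
    show "(\<forall>l<j. column (matrix_of lst j m Cs) l = cols \<mu> j l) \<longleftrightarrow> Cs = ?T"
      using col by (auto simp: list_eq_iff_nth_eq)
  qed simp
  also have "size \<dots> = count (block_aux A m []) ?T"
    by (simp add: count_conv_size_mset)
  also have "\<dots> = of_bool (ordered_partition A m ?T)"
    by (simp add: count_block_aux[OF fin m(2)])
  \<comment> \<open>Disjointness and cardinality of the columns come from \<open>\<mu>\<close>, so
    only the union remains as a condition.\<close>
  also have "ordered_partition A m ?T \<longleftrightarrow> A = (\<Union>l<j. cols \<mu> j l)"
  proof -
    have "disjnt (cols \<mu> j l) (cols \<mu> j l')" if "l < l'" "l' < j" for l l'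
    proof (rule ccontr)
      assume "\<not> ?thesis"
      then obtain S S' where "S \<in> \<mu>" "S' \<in> \<mu>" "length S = j" "length S' = j" "S ! l = S' ! l'"
        by (auto simp: disjnt_def cols_def)
      then show False using BP_unique_index[OF \<mu>, of S S' l l'] that by simp
    qed
    then have "sorted_wrt disjnt ?T" by (simp add: sorted_wrt_iff_nth_less)
    moreover have "\<forall>l<j. card (cols \<mu> j l) = m"
      using card_cols[OF \<mu>] m(1) count_lengths[OF \<mu>] by simp
    ultimately show ?thesis by (auto simp: ordered_partition_def)
  qed
  finally show ?thesis .
qed

lemma size_filter_sum:
  "finite I \<Longrightarrow> size (filter_mset Q (\<Sum>i\<in>I. f i)) = (\<Sum>i\<in>I. size (filter_mset Q (f i)))"
  by (induction I rule: finite_induct) auto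

lemma size_filter_sum_mset:
  "size (filter_mset Q (\<Sum>x\<in>#X. f x)) = (\<Sum>x\<in>#X. size (filter_mset Q (f x)))"
  by (induction X) auto

lemma sum_mset_of_bool: "(\<Sum>x\<in>#X. of_bool (Q x)) = size (filter_mset Q X)"
  by (induction X) auto

text \<open>A matching prefix extends to exactly one matching output and any other prefix to none:
  at each level a single choice of \<open>A\<close>, and for it a single matrix, continues the
  match.\<close>

lemma size_aux_matching:
  assumes "\<mu> \<in> BP n" "listing n lst" "P = lengths \<mu>" "partial_representation n P M"
    "j = Suc (length M)"
  shows "size {#M' \<in># aux lst n P j M. matches \<mu> M'#} = of_bool (matches \<mu> M)"
  using assms
proof (induction lst n P j M rule: aux.induct)
  case (1 lst n P j M)
  consider "max_part P < j" | "j \<le> max_part P" "count P j > 0" | "j \<le> max_part P" "count P j = 0"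
    by linarith
  then show ?case
  proof cases
    case 1
    then have "aux lst n P j M = {#M#}" by (subst aux.simps) simp
    then show ?thesis by simp
  next
    case 2
    let ?As = "{A. A \<subseteq> {..<n} - set (concat (concat M)) \<and> card A = j * count P j}"
    let ?U = "\<lambda>j. \<Union>l<j. cols \<mu> j l"
    have fin: "finite ?As" by (rule finite_subset[of _ "Pow {..<n}"]) auto
    have "size {#M' \<in># aux lst n P j M. matches \<mu> M'#} = (\<Sum>A\<in>?As. \<Sum>R\<in>#block lst A j (count P j).
        size {#M' \<in># aux lst n P (j + 1) (M @ [R]). matches \<mu> M'#})"
      using 2 fin by (subst aux.simps) (simp add: size_filter_sum size_filter_sum_mset)
    also have "\<dots> = (\<Sum>A\<in>?As. of_bool (matches \<mu> M \<and> A = ?U j))"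
    proof (rule sum.cong)
      fix A assume A: "A \<in> ?As"
      then have A': "A \<subseteq> {..<n}" "card A = j * count P j" by auto
      have "(\<Sum>R\<in>#block lst A j (count P j).
            size {#M' \<in># aux lst n P (j + 1) (M @ [R]). matches \<mu> M'#})
          = (\<Sum>R\<in>#block lst A j (count P j).
            of_bool (matches \<mu> M \<and> (\<forall>l<j. column R l = cols \<mu> j l)))"
      proof (rule arg_cong[of _ _ sum_mset], rule image_mset_cong)
        fix R assume R: "R \<in># block lst A j (count P j)"
        then have "partial_representation n P (M @ [R])"
          using A 2 "1.prems" by (intro partial_representation_block[of n lst P M j A R]) auto
        then have "size {#M' \<in># aux lst n P (j + 1) (M @ [R]). matches \<mu> M'#}
            = of_bool (matches \<mu> (M @ [R]))"
          using "1.IH"(1)[of A R] A R 2 "1.prems" by simp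
        then show "size {#M' \<in># aux lst n P (j + 1) (M @ [R]). matches \<mu> M'#}
            = of_bool (matches \<mu> M \<and> (\<forall>l<j. column R l = cols \<mu> j l))"
          using "1.prems"(5) by (simp add: matches_snoc less_Suc_eq_le)
      qed
      also have "\<dots> = of_bool (matches \<mu> M \<and> A = ?U j)"
        unfolding sum_mset_of_bool
        using size_block_matching[OF "1.prems"(1,2) A' _ 2(2)] "1.prems"(3)
        by (cases "matches \<mu> M") auto
      finally show "(\<Sum>R\<in>#block lst A j (count P j).
            size {#M' \<in># aux lst n P (j + 1) (M @ [R]). matches \<mu> M'#})
          = of_bool (matches \<mu> M \<and> A = ?U j)" .
    qed simp
    also have "\<dots> = of_bool (matches \<mu> M)"
    proof (cases "matches \<mu> M")
      case True
      \<comment> \<open>It must be checked that \<open>?U j\<close> is an admissible choice of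
        \<open>A\<close>. As \<open>M\<close> matches, its entries lie in o-blocks of
        \<open>\<mu>\<close> shorter than \<open>j\<close>, hence outside
        \<open>?U j\<close>.\<close>
      have "set (concat (concat M)) \<subseteq> (\<Union>i<length M. ?U (Suc i))"
      proof
        fix x assume "x \<in> set (concat (concat M))"
        then obtain R where "R \<in> set M" "x \<in> set (concat R)" by auto
        then obtain i where i: "i < length M" "x \<in> set (concat (M ! i))"
          by (metis in_set_conv_nth)
        have "\<forall>r\<in>set (M ! i). length r = Suc i"
          using "1.prems"(4) i(1) by (simp add: partial_representation_def)
        from set_concat_conv_column[OF this]
        have "x \<in> (\<Union>l<Suc i. column (M ! i) l)" using i(2) by simp
        then show "x \<in> (\<Union>i<length M. ?U (Suc i))"
          using True i(1) unfolding matches_def less_Suc_eq_le by auto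
      qed
      moreover have "?U j \<inter> ?U (Suc i) = {}" if "i < length M" for i
        unfolding Union_cols using BP_unique_block[OF "1.prems"(1)] that "1.prems"(5) by fastforce
      moreover have "?U j \<subseteq> {..<n}"
        unfolding Union_cols using "1.prems"(1) unfolding BP_def by blast
      ultimately have sub: "?U j \<subseteq> {..<n} - set (concat (concat M))" by blast
      have "card (?U j) = (\<Sum>l<j. card (cols \<mu> j l))"
      proof (rule card_UN_disjoint)
        show "\<forall>l\<in>{..<j}. finite (cols \<mu> j l)"
          using BP_finite[OF "1.prems"(1)] by (simp add: cols_def)
        show "\<forall>l\<in>{..<j}. \<forall>l'\<in>{..<j}. l \<noteq> l' \<longrightarrow> cols \<mu> j l \<inter> cols \<mu> j l' = {}"
          using BP_unique_index[OF "1.prems"(1)] by (auto simp: cols_def)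
      qed simp
      also have "\<dots> = j * count P j"
        using card_cols[OF "1.prems"(1)] count_lengths[OF "1.prems"(1)] "1.prems"(3) by simp
      finally have "?U j \<in> ?As" using sub by simp
      then have "(\<Sum>A\<in>?As. if A = ?U j then 1 else 0 :: nat) = 1"
        using fin by (subst sum.delta) auto
      then show ?thesis using True by (simp add: of_bool_def)
    qed simp
    finally show ?thesis .
  next
    case 3
    \<comment> \<open>Without o-blocks of length \<open>j\<close>, the columns of
      \<open>\<mu>\<close> and those of the empty matrix are all empty, so appending it preserves
      the match.\<close>
    have "{S \<in> \<mu>. length S = j} = {}"
      using 3(2) count_lengths[OF "1.prems"(1)] "1.prems"(3) BP_finite[OF "1.prems"(1)] by simp
    then have "matches \<mu> (M @ [[]]) \<longleftrightarrow> matches \<mu> M"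
      using "1.prems"(5) by (simp add: matches_snoc column_def cols_def)
    moreover have "partial_representation n P (M @ [[]])"
      using partial_representation_empty "1.prems"(4,5) 3(2) by simp
    moreover have "aux lst n P j M = aux lst n P (j + 1) (M @ [[]])"
      using 3 by (subst aux.simps) simp
    moreover have "\<not> max_part P < j" "\<not> 0 < count P j" using 3 by auto
    ultimately show ?thesis
      using "1.IH"(2) "1.prems" by simp
  qed
qed

section \<open>Outputs in a given class\<close>

text \<open>Equal columns have equal cardinalities, which forces the partition. Conversely,
  \<open>matches\<close> is silent about lengths above \<open>max_part P\<close>, and
  \<open>P = lengths \<mu>\<close> excludes such o-blocks.\<close>

lemma represented_order_equiv_iff:
  assumes \<mu>: "\<mu> \<in> BP n" and lst: "listing n lst" and P: "P \<in> int_partitions n"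
    and M: "M \<in># aux lst n P 1 []"
  shows "phi \<mu> = phi (represented_order M) \<longleftrightarrow> P = lengths \<mu> \<and> matches \<mu> M"
proof -
  note out = aux_output[OF lst P M]
  note cols = cols_represented_order[OF out(1)]
  note iff = phi_eq_iff[OF \<mu> out(4)]
  show ?thesis
  proof
    assume "phi \<mu> = phi (represented_order M)"
    then have eq: "cols \<mu> j l = cols (represented_order M) j l" if "l < j" for j l
      using iff that by blast
    have "count P j = count (lengths \<mu>) j" for j
    \<comment> \<open>Multiplicities are read off the column of index \<open>0\<close>, which is
      available only for positive \<open>j\<close>; the part \<open>0\<close> occurs in no integer
      partition.\<close>
    proof (cases "j = 0")
      case True
      then show ?thesis
        using P lengths_in_int_partitions[OF \<mu>] by (simp add: int_partitions_def not_in_iff)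
    next
      case False
      have "count (lengths \<mu>) j = count (lengths (represented_order M)) j"
        using count_lengths[OF \<mu>] count_lengths[OF out(4)] card_cols[OF \<mu>, of 0 j]
          card_cols[OF out(4), of 0 j] eq[of 0 j] False by simp
      also have "\<dots> = count P j"
      proof (cases "j \<le> length M")
        case True
        then show ?thesis using count_lengths_represented_order[OF out(1,4)] False by simp
      next
        case out_of_range: False
        then have "j \<notin># P" using int_partition_parts(1)[OF P] out(2) by auto
        then show ?thesis
          using count_lengths_represented_order[OF out(1,4)] False out_of_range
          by (simp add: not_in_iff)
      qed
      finally show ?thesis ..
    qed
    then have "P = lengths \<mu>" by (rule multiset_eqI)
    moreover have "matches \<mu> M"
      unfolding matches_def using eq cols by (auto simp: less_Suc_eq_le)
    ultimately show "P = lengths \<mu> \<and> matches \<mu> M" ..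
  next
    assume *: "P = lengths \<mu> \<and> matches \<mu> M"
    have "cols \<mu> j l = cols (represented_order M) j l" if "l < j" for j l
    proof (cases "j \<le> length M")
      case True
      then show ?thesis
        using * that cols[of j l] unfolding matches_def
        by (cases j) (auto simp: less_Suc_eq_le)
    next
      case False
      then have "j \<notin># P" using int_partition_parts(1)[OF P] out(2) by auto
      then have "{S \<in> \<mu>. length S = j} = {}"
        using * count_lengths[OF \<mu>, of j] BP_finite[OF \<mu>] by (simp add: not_in_iff)
      then have "cols \<mu> j l = {}" by (simp only: cols_def image_empty)
      then show ?thesis using False that cols[of j l] by simp
    qed
    then show "phi \<mu> = phi (represented_order M)" using iff by blast
  qed
qed

theorem theorem3:
  fixes n :: nat and lst :: "nat set \<Rightarrow> nat list"
  assumes "n \<ge> 1" and "listing n lst"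
  shows "(\<forall>M\<in>#EnumBPeq0 lst n.
            (\<exists>P\<in>int_partitions n. matrix_representation n P M) \<and> represented_order M \<in> BP n) \<and>
         (\<forall>c\<in>BP0 n. size {#M \<in># EnumBPeq0 lst n. represented_order M \<in> c#} = 1)"
proof (intro conjI ballI)
  fix M assume "M \<in># EnumBPeq0 lst n"
  then obtain P where "P \<in> int_partitions n" "M \<in># aux lst n P 1 []"
    by (auto simp: EnumBPeq0_def set_mset_sum finite_int_partitions)
  then show "\<exists>P\<in>int_partitions n. matrix_representation n P M" "represented_order M \<in> BP n"
    using aux_output[OF assms(2)] by blast+
next
  fix c assume "c \<in> BP0 n"
  then obtain \<mu> where \<mu>: "\<mu> \<in> BP n" and c: "c = {\<mu>' \<in> BP n. phi \<mu> = phi \<mu>'}"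
    by (auto simp: BP0_def equiv0_def quotient_def)
  \<comment> \<open>Summing over all partitions leaves the contribution of
    \<open>lengths \<mu>\<close> alone.\<close>
  have P: "size {#M \<in># aux lst n P 1 []. represented_order M \<in> c#} = of_bool (P = lengths \<mu>)"
    if P: "P \<in> int_partitions n" for P
  proof -
    have "{#M \<in># aux lst n P 1 []. represented_order M \<in> c#}
        = {#M \<in># aux lst n P 1 []. P = lengths \<mu> \<and> matches \<mu> M#}"
      using represented_order_equiv_iff[OF \<mu> assms(2) P] aux_output(4)[OF assms(2) P]
      by (intro filter_mset_cong) (auto simp: c)
    \<comment> \<open>The empty prefix matches vacuously and therefore has exactly one matching
      completion.\<close>
    moreover have "size {#M \<in># aux lst n P 1 []. matches \<mu> M#} = 1" if "P = lengths \<mu>"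
      using size_aux_matching[OF \<mu> assms(2) that partial_representation_Nil, of 1]
      by (simp add: matches_def)
    ultimately show ?thesis by (cases "P = lengths \<mu>") auto
  qed
  have "size {#M \<in># EnumBPeq0 lst n. represented_order M \<in> c#}
      = (\<Sum>P\<in>int_partitions n. of_bool (P = lengths \<mu>))"
    unfolding EnumBPeq0_def using P by (simp add: size_filter_sum finite_int_partitions)
  also have "\<dots> = 1"
    using lengths_in_int_partitions[OF \<mu>] by (simp add: of_bool_def finite_int_partitions)
  finally show "size {#M \<in># EnumBPeq0 lst n. represented_order M \<in> c#} = 1" .
qed

end
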